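(* Let $p>3$ be a prime and $k$ an integer. Then the set of all functions $\eta^{r_1}(z)\eta^{r_p}(pz)$, with $r_1,r_p\in\mathbb{Z}$, that lie in $M_k(\Gamma_1(p))$ is linearly independent over $\mathbb{C}$.
   Context: $\eta(z)=q^{1/24}\prod_{n\ge1}(1-q^n)$, $q=e^{2\pi iz}$, is the Dedekind eta-function. $\Gamma_1(p)$ is the group of matrices in $\mathrm{SL}_2(\mathbb{Z})$ congruent to $\begin{pmatrix}1&*\\0&1\end{pmatrix}$ modulo $p$, and $M_k(\Gamma_1(p))$ is the space of weight $k$ holomorphic modular forms on $\Gamma_1(p)$. *)

theory Defs
  imports
    "HOL-Complex_Analysis.Complex_Analysis"
    "HOL-Number_Theory.Number_Theory"
    "HOL-Library.Function_Algebras"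
begin

unbundle no fps_syntax

text \<open>
  A function on the upper half-plane is represented by its extension by zero to all of the
  complex plane, so that equality and linear combinations of such functions on the
  half-plane agree with equality and pointwise linear combinations of total functions.
\<close>

interpretation cfun: vector_space "\<lambda>(c :: complex) (f :: complex \<Rightarrow> complex) z. c * f z"
  by unfold_locales (auto simp: fun_eq_iff algebra_simps)

definition upper_half_plane :: "complex set" where
  "upper_half_plane = {z. Im z > 0}"

definition dedekind_eta :: "complex \<Rightarrow> complex" where
  "dedekind_eta z = exp (2 * pi * \<i> * z / 24) * (\<Prod>n. 1 - exp (2 * pi * \<i> * z) ^ Suc n)"

definition eta_quotient :: "nat \<Rightarrow> int \<Rightarrow> int \<Rightarrow> complex \<Rightarrow> complex" where
  "eta_quotient p r\<^sub>1 r\<^sub>p z =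
     (if z \<in> upper_half_plane
      then dedekind_eta z powi r\<^sub>1 * dedekind_eta (of_nat p * z) powi r\<^sub>p else 0)"

definition SL2Z :: "(int ^ 2 ^ 2) set" where
  "SL2Z = {A. det A = 1}"

definition Gamma1 :: "nat \<Rightarrow> (int ^ 2 ^ 2) set" where
  "Gamma1 N = {A \<in> SL2Z. [A $ 1 $ 1 = 1] (mod int N) \<and> [A $ 2 $ 1 = 0] (mod int N) \<and>
                         [A $ 2 $ 2 = 1] (mod int N)}"

definition moebius :: "int ^ 2 ^ 2 \<Rightarrow> complex \<Rightarrow> complex" where
  "moebius A z = (of_int (A $ 1 $ 1) * z + of_int (A $ 1 $ 2)) /
                 (of_int (A $ 2 $ 1) * z + of_int (A $ 2 $ 2))"

definition slash :: "int \<Rightarrow> (complex \<Rightarrow> complex) \<Rightarrow> int ^ 2 ^ 2 \<Rightarrow> complex \<Rightarrow> complex" where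
  "slash k f A z = (of_int (A $ 2 $ 1) * z + of_int (A $ 2 $ 2)) powi (- k) * f (moebius A z)"

text \<open>
  On the upper half-plane, \<open>f\<close> is a function \<open>g\<close> of the local parameter
  \<open>q\<^sub>h = exp (2 \<pi> \<i> z / h)\<close> for some period \<open>h\<close>, where \<open>g\<close> is holomorphic also at
  \<open>q\<^sub>h = 0\<close>; that is, \<open>f\<close> has a Fourier expansion in non-negative powers of \<open>q\<^sub>h\<close>.
\<close>

definition holomorphic_at_cusp_infinity :: "(complex \<Rightarrow> complex) \<Rightarrow> bool" where
  "holomorphic_at_cusp_infinity f \<longleftrightarrow>
     (\<exists>(h :: nat) g. h > 0 \<and> g holomorphic_on ball 0 1 \<and>
        (\<forall>z \<in> upper_half_plane. f z = g (exp (2 * pi * \<i> * z / of_nat h))))"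

text \<open>
  Intended for congruence subgroups \<open>\<Gamma>\<close>. Every cusp is of the form \<open>A \<infinity>\<close> with \<open>A \<in> SL2Z\<close>,
  so the last condition is holomorphy at all cusps.
\<close>

definition modular_forms :: "int \<Rightarrow> (int ^ 2 ^ 2) set \<Rightarrow> (complex \<Rightarrow> complex) set" where
  "modular_forms k \<Gamma> = {f.
     (\<forall>z. z \<notin> upper_half_plane \<longrightarrow> f z = 0) \<and>
     f holomorphic_on upper_half_plane \<and>
     (\<forall>A \<in> \<Gamma>. \<forall>z \<in> upper_half_plane. slash k f A z = f z) \<and>
     (\<forall>A \<in> SL2Z. holomorphic_at_cusp_infinity (slash k f A))}"

end

theory Submission
  imports Defs "HOL-Real_Asymp.Real_Asymp"
begin

text \<open>
  Already the set of all functions \<open>\<eta>(z)\<^sup>a \<eta>(pz)\<^sup>b\<close> with integers \<open>a\<close>, \<open>b\<close>, modular or not, is linearly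
  independent, because their growth rates as \<open>z = it\<close> tends to \<open>0\<close> are pairwise different.
  Write \<open>\<eta>(it) = exp (-2\<pi>t/24 - L(2\<pi>t))\<close> with \<open>L(x) = \<Sum>n\<ge>1. h(nx)\<close> and
  \<open>h(u) = -ln (1 - exp (-u))\<close>, and let \<open>D(x) = L(x) - p L(px)\<close>. Comparing each block of \<open>p\<close>
  consecutive terms of \<open>L(x)\<close> with its last one gives \<open>D(x) \<le> p h(x)\<close>, while \<open>D(x)\<close> eventually
  exceeds every partial sum of a divergent harmonic series. As \<open>h(x) = o(L(px))\<close>, the combination
  \<open>a L(x) + b L(px) = a D(x) + (ap + b) L(px)\<close> tends to plus or minus infinity unless \<open>a = b = 0\<close>.
\<close>

section \<open>Linear independence of functions with pairwise different growth\<close>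

text \<open>Among the finitely many indices with nonzero coefficient, one dominates all others.
  Dividing the relation by its function and passing to the limit leaves only its coefficient, which
  must therefore vanish.\<close>

lemma asymptotic_scale_linear_independent:
  fixes f :: "'i \<Rightarrow> 'a \<Rightarrow> 'b :: real_normed_field"
  assumes "finite I" and "F \<noteq> bot"
    and nz: "\<And>i. i \<in> I \<Longrightarrow> eventually (\<lambda>x. f i x \<noteq> 0) F"
    and ratio: "\<And>i j. i \<in> I \<Longrightarrow> j \<in> I \<Longrightarrow> i \<noteq> j \<Longrightarrow>
                  ((\<lambda>x. f i x / f j x) \<longlongrightarrow> 0) F \<or> ((\<lambda>x. f j x / f i x) \<longlongrightarrow> 0) F"
    and zero: "eventually (\<lambda>x. (\<Sum>i\<in>I. c i * f i x) = 0) F"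
    and "i \<in> I"
  shows "c i = 0"
proof (rule ccontr)
  assume "c i \<noteq> 0"
  define J where "J = {i \<in> I. c i \<noteq> 0}"
  have J: "finite J" "J \<noteq> {}" "J \<subseteq> I"
    using \<open>finite I\<close> \<open>c i \<noteq> 0\<close> \<open>i \<in> I\<close> by (auto simp: J_def)
  have "\<exists>m\<in>J. \<forall>j\<in>J - {m}. ((\<lambda>x. f j x / f m x) \<longlongrightarrow> 0) F"
    using J
  proof (induction J rule: finite_ne_induct)
    case (singleton x)
    then show ?case by simp
  next
    case (insert i J)
    then obtain m where m: "m \<in> J" "\<And>j. j \<in> J - {m} \<Longrightarrow> ((\<lambda>x. f j x / f m x) \<longlongrightarrow> 0) F"
      by auto
    have "i \<noteq> m" "i \<in> I" "m \<in> I" using insert m by auto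
    then consider "((\<lambda>x. f i x / f m x) \<longlongrightarrow> 0) F" | "((\<lambda>x. f m x / f i x) \<longlongrightarrow> 0) F"
      using ratio by blast
    then show ?case
    proof cases
      case 1
      then show ?thesis using m by (intro bexI[of _ m]) auto
    next
      case 2
      have "((\<lambda>x. f j x / f i x) \<longlongrightarrow> 0) F" if "j \<in> J" for j
      proof (cases "j = m")
        case False
        \<comment> \<open>Dominance is transitive: the new index \<open>i\<close> dominates the old
          maximum \<open>m\<close>, hence everything below \<open>m\<close>.\<close>
        have "((\<lambda>x. f j x / f m x * (f m x / f i x)) \<longlongrightarrow> 0 * 0) F"
          using 2 m that False by (intro tendsto_mult) auto
        moreover have "eventually (\<lambda>x. f j x / f m x * (f m x / f i x) = f j x / f i x) F"
          using nz[OF \<open>m \<in> I\<close>] by eventually_elim simp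
        ultimately show ?thesis
          unfolding mult_zero_left by (rule Lim_transform_eventually)
      qed (use 2 in simp)
      then show ?thesis by (intro bexI[of _ i]) auto
    qed
  qed
  then obtain m where m: "m \<in> J" "\<And>j. j \<in> J - {m} \<Longrightarrow> ((\<lambda>x. f j x / f m x) \<longlongrightarrow> 0) F"
    by blast
  have "((\<lambda>x. c m + (\<Sum>j\<in>J-{m}. c j * (f j x / f m x))) \<longlongrightarrow> c m + (\<Sum>j\<in>J-{m}. c j * 0)) F"
    by (intro tendsto_intros m)
  moreover have "eventually (\<lambda>x. c m + (\<Sum>j\<in>J-{m}. c j * (f j x / f m x)) = 0) F"
    using zero nz[OF subsetD[OF J(3) m(1)]]
  proof eventually_elim
    case (elim x)
    have "m \<in> I" using m J by auto
    have "0 = (\<Sum>j\<in>J. c j * f j x)"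
      using elim(1) sum.mono_neutral_right[of I J "\<lambda>j. c j * f j x"] J \<open>finite I\<close>
      by (auto simp: J_def)
    also have "\<dots> = c m * f m x + (\<Sum>j\<in>J-{m}. c j * f j x)"
      using m J by (simp add: sum.remove)
    finally have "0 = (c m * f m x + (\<Sum>j\<in>J-{m}. c j * f j x)) / f m x"
      by simp
    also have "\<dots> = c m + (\<Sum>j\<in>J-{m}. c j * (f j x / f m x))"
      using elim(2) by (simp add: add_divide_distrib sum_divide_distrib)
    finally show ?case by simp
  qed
  ultimately have "((\<lambda>x. 0) \<longlongrightarrow> c m + (\<Sum>j\<in>J-{m}. c j * 0)) F"
    by (rule Lim_transform_eventually)
  then have "c m = 0"
    using \<open>F \<noteq> bot\<close> by (simp add: tendsto_const_iff)
  then show False using m by (simp add: J_def)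
qed

section \<open>The logarithm of the Euler product\<close>

text \<open>The function h of the overview. The sign makes it positive and decreasing for positive
  arguments, so sums can be compared termwise.\<close>

definition neg_log1m_exp :: "real \<Rightarrow> real" where
  "neg_log1m_exp u = - ln (1 - exp (- u))"

text \<open>The function L of the overview: for x > 0, minus the logarithm of the product of 1 -
  exp(-nx) over n \<ge> 1.\<close>

definition euler_log :: "real \<Rightarrow> real" where
  "euler_log x = (\<Sum>n. neg_log1m_exp (real (Suc n) * x))"

lemma neg_log1m_exp_pos: "u > 0 \<Longrightarrow> neg_log1m_exp u > 0"
  by (simp add: neg_log1m_exp_def)

lemma neg_log1m_exp_antimono: "0 < u \<Longrightarrow> u \<le> v \<Longrightarrow> neg_log1m_exp v \<le> neg_log1m_exp u"
  by (simp add: neg_log1m_exp_def)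

text \<open>With y = exp(-x), the factorization 1 - y^n = (1 - y)(1 + ... + y^(n-1)) gives 1 - y^n
  \<le> n(1 - y); take logarithms. Dilating the argument thus costs at most an additive
  constant.\<close>

lemma neg_log1m_exp_mult_ge:
  assumes "x > 0" "n > 0"
  shows "neg_log1m_exp (real n * x) \<ge> neg_log1m_exp x - ln (real n)"
proof -
  define y where "y = exp (- x)"
  have y: "0 < y" "y < 1" using assms by (auto simp: y_def)
  have yn: "exp (- (real n * x)) = y ^ n"
    by (simp add: y_def flip: exp_of_nat_mult)
  have "1 - y ^ n = (1 - y) * (\<Sum>i<n. y ^ i)"
    by (rule one_diff_power_eq)
  also have "(\<Sum>i<n. y ^ i) \<le> (\<Sum>i<n. 1)"
    using y by (intro sum_mono power_le_one) auto
  finally have "1 - y ^ n \<le> real n * (1 - y)"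
    using y by (simp add: mult.commute)
  moreover have "1 - y ^ n > 0"
    using y assms by (simp add: power_less_one_iff)
  ultimately have "ln (1 - y ^ n) \<le> ln (real n * (1 - y))"
    by simp
  also have "\<dots> = ln (real n) + ln (1 - y)"
    using y assms by (simp add: ln_mult)
  finally show ?thesis
    by (simp add: neg_log1m_exp_def yn flip: y_def)
qed

text \<open>Comparison with a geometric series: -ln(1 - w) \<le> w/(1 - w) at w = y^(n+1), where y =
  exp(-x), and 1 - w \<ge> 1 - y.\<close>

lemma summable_neg_log1m_exp:
  assumes "x > 0"
  shows "summable (\<lambda>n. neg_log1m_exp (real (Suc n) * x))"
proof (rule summable_comparison_test)
  define y where "y = exp (- x)"
  have y: "0 < y" "y < 1" using assms by (auto simp: y_def)
  show "summable (\<lambda>n. y ^ Suc n / (1 - y))"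
    using y by (intro summable_divide) (simp add: summable_Suc_iff)
  show "\<exists>N. \<forall>n\<ge>N. norm (neg_log1m_exp (real (Suc n) * x)) \<le> y ^ Suc n / (1 - y)"
  proof (intro exI allI impI)
    fix n :: nat
    have e: "exp (- (real (Suc n) * x)) = y ^ Suc n"
      unfolding y_def by (subst exp_of_nat_mult [symmetric]) simp
    have yn: "y ^ Suc n \<le> y" "y ^ Suc n < 1" "y ^ Suc n > 0"
      using y power_decreasing[of 1 "Suc n" y] by (auto simp: power_Suc_less_one simp del: power_Suc)
    have "neg_log1m_exp (real (Suc n) * x) = ln (1 / (1 - y ^ Suc n))"
      using yn unfolding neg_log1m_exp_def e by (subst ln_div) auto
    also have "\<dots> \<le> 1 / (1 - y ^ Suc n) - 1"
      using yn by (intro ln_le_minus_one) auto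
    also have "\<dots> = y ^ Suc n / (1 - y ^ Suc n)"
      using yn by (simp add: field_simps)
    also have "\<dots> \<le> y ^ Suc n / (1 - y)"
      using yn y by (intro divide_left_mono mult_pos_pos) auto
    finally show "norm (neg_log1m_exp (real (Suc n) * x)) \<le> y ^ Suc n / (1 - y)"
      using neg_log1m_exp_pos[of "real (Suc n) * x"] assms by simp
  qed
qed

lemma dedekind_eta_imaginary_axis:
  assumes "t > 0"
  shows "dedekind_eta (\<i> * of_real t) =
           of_real (exp (- (2 * pi * t / 24) - euler_log (2 * pi * t)))"
proof -
  define q where "q = exp (- (2 * pi * t))"
  have q: "0 < q" "q < 1" using assms by (auto simp: q_def)
  have e: "exp (- (real (Suc n) * (2 * pi * t))) = q ^ Suc n" for n
    unfolding q_def by (subst exp_of_nat_mult [symmetric]) simp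
  have pos: "1 - q ^ Suc n > 0" for n
    using q by (simp add: power_less_one_iff del: power_Suc)
  have s: "summable (\<lambda>n. neg_log1m_exp (real (Suc n) * (2 * pi * t)))"
    using assms by (intro summable_neg_log1m_exp) auto
  have "(\<lambda>n. - neg_log1m_exp (real (Suc n) * (2 * pi * t))) sums - euler_log (2 * pi * t)"
    unfolding euler_log_def by (intro sums_minus summable_sums s)
  \<comment> \<open>Exponentials of partial sums are partial products. No factor vanishes, so the
    first disjunct of \<open>has_prod_def\<close> applies.\<close>
  then have "(\<lambda>n. exp (- neg_log1m_exp (real (Suc n) * (2 * pi * t))))
               has_prod exp (- euler_log (2 * pi * t))"
    unfolding has_prod_def by (intro disjI1 sums_imp_has_prod_exp)
  then have "(\<lambda>n. 1 - q ^ Suc n) has_prod exp (- euler_log (2 * pi * t))"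
    using pos by (simp only: neg_log1m_exp_def e minus_minus exp_ln)
  then have "(\<lambda>n. complex_of_real (1 - q ^ Suc n)) has_prod of_real (exp (- euler_log (2 * pi * t)))"
    by (simp only: has_prod_of_real_iff)
  then have prod: "(\<Prod>n. complex_of_real (1 - q ^ Suc n)) = of_real (exp (- euler_log (2 * pi * t)))"
    by (rule has_prod_unique [symmetric])
  have q': "exp (2 * pi * \<i> * (\<i> * of_real t)) = complex_of_real q"
    by (simp add: q_def algebra_simps flip: exp_of_real)
  have "exp (2 * pi * \<i> * (\<i> * of_real t) / 24) = complex_of_real (exp (- (2 * pi * t / 24)))"
    by (simp add: algebra_simps flip: exp_of_real)
  with prod have "dedekind_eta (\<i> * of_real t) =
      of_real (exp (- (2 * pi * t / 24)) * exp (- euler_log (2 * pi * t)))"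
    unfolding dedekind_eta_def q' by (simp only: of_real_diff of_real_1 of_real_power of_real_mult)
  then show ?thesis
    by (simp only: diff_conv_add_uminus exp_add)
qed

section \<open>The defect D(x) = L(x) - p L(px)\<close>

text \<open>Block n of L(x) consists of the terms np + 1 to np + p. Its last argument is (n+1)px, so
  p copies of the last terms add up to p L(px).\<close>

lemma euler_log_defect_sums:
  assumes "x > 0" "p > 0"
  shows "(\<lambda>n. \<Sum>i<p. neg_log1m_exp (real (n * p + i + 1) * x)
                   - neg_log1m_exp (real (n * p + p) * x))
           sums (euler_log x - real p * euler_log (real p * x))"
proof -
  have "(\<lambda>n. neg_log1m_exp (real (Suc n) * x)) sums euler_log x"
    unfolding euler_log_def using assms by (intro summable_sums summable_neg_log1m_exp)
  from sums_group[OF this \<open>p > 0\<close>]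
  have 1: "(\<lambda>n. \<Sum>i<p. neg_log1m_exp (real (n * p + i + 1) * x)) sums euler_log x"
    by (simp add: sum.atLeastLessThan_shift_0 atLeast0LessThan add_ac flip: of_nat_Suc)
  have "(\<lambda>n. neg_log1m_exp (real (Suc n) * (real p * x))) sums euler_log (real p * x)"
    unfolding euler_log_def using assms by (intro summable_sums summable_neg_log1m_exp) auto
  from sums_mult[OF this, of "real p"]
  have 2: "(\<lambda>n. real p * neg_log1m_exp (real (n * p + p) * x)) sums (real p * euler_log (real p * x))"
    by (simp add: algebra_simps)
  from sums_diff[OF 1 2] show ?thesis
    by (simp add: sum_subtractf)
qed

lemma euler_log_defect_le:
  assumes "x > 0" "p > 0"
  shows "euler_log x - real p * euler_log (real p * x) \<le> real p * neg_log1m_exp x"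
proof (rule LIMSEQ_le_const2)
  show "(\<lambda>N. \<Sum>n<N. \<Sum>i<p. neg_log1m_exp (real (n * p + i + 1) * x)
                         - neg_log1m_exp (real (n * p + p) * x))
           \<longlonglongrightarrow> euler_log x - real p * euler_log (real p * x)"
    using euler_log_defect_sums[OF assms] by (simp only: sums_def)
  have "(\<Sum>n<N. \<Sum>i<p. neg_log1m_exp (real (n * p + i + 1) * x)
                      - neg_log1m_exp (real (n * p + p) * x)) \<le> real p * neg_log1m_exp x" for N
  proof -
    let ?h = "\<lambda>n. neg_log1m_exp (real (n * p + 1) * x)"
    \<comment> \<open>By monotonicity of h, each term is raised to the first of its block, and the
      subtracted one is lowered from index np + p to np + p + 1, the start of the next block. The
      sum over n then telescopes.\<close>
    have "(\<Sum>n<N. \<Sum>i<p. neg_log1m_exp (real (n * p + i + 1) * x)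
                        - neg_log1m_exp (real (n * p + p) * x))
            \<le> (\<Sum>n<N. \<Sum>i<p. ?h n - ?h (Suc n))"
      using assms by (intro sum_mono diff_mono neg_log1m_exp_antimono mult_right_mono)
         (auto simp: add_nonneg_pos add_pos_nonneg)
    also have "\<dots> = real p * (\<Sum>n<N. ?h n - ?h (Suc n))"
      by (simp add: sum_distrib_left)
    also have "\<dots> = real p * (?h 0 - ?h N)"
      by (subst sum_lessThan_telescope') simp
    also have "\<dots> \<le> real p * neg_log1m_exp x"
      using neg_log1m_exp_pos[of "real (N * p + 1) * x"] assms
      by (intro mult_left_mono) (auto simp: add_pos_nonneg)
    finally show ?thesis .
  qed
  then show "\<exists>N. \<forall>n\<ge>N. (\<Sum>n<n. \<Sum>i<p. neg_log1m_exp (real (n * p + i + 1) * x)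
                      - neg_log1m_exp (real (n * p + p) * x)) \<le> real p * neg_log1m_exp x"
    by blast
qed

text \<open>Near 0, h(u) = -ln u + o(1), so the ln x contributions cancel.\<close>

lemma neg_log1m_exp_diff_tendsto:
  assumes "a > 0" "b > 0"
  shows "((\<lambda>x. neg_log1m_exp (a * x) - neg_log1m_exp (b * x)) \<longlongrightarrow> ln b - ln a) (at_right 0)"
  unfolding neg_log1m_exp_def using assms by real_asymp

text \<open>All blocks are nonnegative, so D(x) is at least the sum over finitely many of them. As x
  tends to 0 that sum has a limit bounded below by a multiple of a harmonic number.\<close>

lemma euler_log_defect_at_top:
  assumes "p > 1"
  shows "filterlim (\<lambda>x. euler_log x - real p * euler_log (real p * x)) at_top (at_right 0)"
  unfolding filterlim_at_top
proof
  fix C :: real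
  \<comment> \<open>Only the summand i = 0 of each block is kept; \<open>?l\<close> is its limit as
    x tends to 0.\<close>
  let ?d = "\<lambda>n x. neg_log1m_exp (real (n * p + 1) * x) - neg_log1m_exp (real (n * p + p) * x)"
  let ?l = "\<lambda>n. ln (real (n * p + p)) - ln (real (n * p + 1))"
  have l: "?l n \<ge> (1 - 1 / p) * inverse (real (Suc n))" for n
  proof -
    \<comment> \<open>The quotient falls short of 1 by (p - 1)/(p(n + 1)), which yields the harmonic
      term.\<close>
    have "ln (real (n * p + 1) / real (n * p + p)) \<le> real (n * p + 1) / real (n * p + p) - 1"
      using assms by (intro ln_le_minus_one divide_pos_pos) (auto simp: add_pos_nonneg add_nonneg_pos)
    also have "\<dots> = - (1 - 1 / p) * inverse (real (Suc n))"
    proof -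
      have "real (n * p + p) = real p * real (Suc n)"
           "real (n * p + 1) = real p * real (Suc n) - (real p - 1)"
        by (simp_all add: algebra_simps)
      moreover have "real p > 0" "real (Suc n) > 0"
        using assms by auto
      ultimately show ?thesis
        by (simp only: diff_divide_distrib) (simp add: field_simps del: of_nat_Suc)
    qed
    also have "ln (real (n * p + 1) / real (n * p + p)) = - ?l n"
      using assms by (subst ln_div) (auto simp del: of_nat_add of_nat_mult)
    finally show ?thesis by (simp only: minus_mult_left neg_le_iff_le)
  qed
  have "filterlim (\<lambda>N. (1 - 1 / p) * harm N) at_top sequentially"
    using assms by (intro filterlim_tendsto_pos_mult_at_top[OF tendsto_const _ harm_at_top]) auto
  \<comment> \<open>The number of blocks depends on \<open>C\<close> alone, so the limit in x is
    taken of a fixed finite sum.\<close>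
  then obtain N where "(1 - 1 / p) * harm N > C"
    unfolding filterlim_at_top_dense using eventually_happens'[OF sequentially_bot] by blast
  also have "(1 - 1 / p) * harm N = (\<Sum>n<N. (1 - 1 / p) * inverse (real (Suc n)))"
    unfolding harm_def sum_distrib_left
    by (simp only: One_nat_def sum.atLeast1_atMost_eq)
  also have "\<dots> \<le> (\<Sum>n<N. ?l n)"
    by (intro sum_mono l)
  finally have C: "C < (\<Sum>n<N. ?l n)" .
  have "((\<lambda>x. \<Sum>n<N. ?d n x) \<longlongrightarrow> (\<Sum>n<N. ?l n)) (at_right 0)"
    using assms by (intro tendsto_sum neg_log1m_exp_diff_tendsto) (auto simp del: of_nat_add of_nat_mult)
  from order_tendstoD(1)[OF this C] eventually_at_right_less
  show "eventually (\<lambda>x. C \<le> euler_log x - real p * euler_log (real p * x)) (at_right 0)"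
  proof eventually_elim
    case (elim x)
    let ?s = "\<lambda>n. \<Sum>i<p. neg_log1m_exp (real (n * p + i + 1) * x)
                       - neg_log1m_exp (real (n * p + p) * x)"
    have nn: "neg_log1m_exp (real (n * p + i + 1) * x) - neg_log1m_exp (real (n * p + p) * x) \<ge> 0"
      if "i < p" for n i
    proof -
      have "0 < real (n * p + i + 1) * x" "real (n * p + i + 1) * x \<le> real (n * p + p) * x"
        using that elim by (auto intro!: mult_pos_pos mult_right_mono simp del: of_nat_add of_nat_mult)
      then show ?thesis
        using neg_log1m_exp_antimono by simp
    qed
    note sums = euler_log_defect_sums[OF elim(2), of p]
    have "(\<Sum>n<N. ?d n x) \<le> (\<Sum>n<N. ?s n)"
    proof (rule sum_mono)
      fix n
      show "?d n x \<le> ?s n"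
        using member_le_sum[of 0 "{..<p}" "\<lambda>i. neg_log1m_exp (real (n * p + i + 1) * x)
                       - neg_log1m_exp (real (n * p + p) * x)"] nn assms by auto
    qed
    also have "\<dots> \<le> suminf ?s"
      using sums assms nn by (intro sum_le_suminf sums_summable[OF sums] ballI sum_nonneg) auto
    also have "\<dots> = euler_log x - real p * euler_log (real p * x)"
      using sums_unique[OF sums] assms by simp
    finally show ?case using elim by simp
  qed
qed

section \<open>Growth of integer combinations of L(x) and L(px)\<close>

text \<open>Each of the first N terms of L(px) is at least h(Npx) \<ge> h(x) - ln(Np). Since N is
  arbitrary, h(x) = o(L(px)) as x tends to 0 from above.\<close>

lemma euler_log_ge:
  assumes "x > 0" "p > 0" "N > 0"
  shows "euler_log (real p * x) \<ge> real N * (neg_log1m_exp x - ln (real (N * p)))"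
proof -
  have "real N * (neg_log1m_exp x - ln (real (N * p)))
          \<le> (\<Sum>n<N. neg_log1m_exp (real (N * p) * x))"
    using neg_log1m_exp_mult_ge[of x "N * p"] assms by (simp add: mult_left_mono)
  also have "\<dots> \<le> (\<Sum>n<N. neg_log1m_exp (real (Suc n) * (real p * x)))"
  proof (intro sum_mono neg_log1m_exp_antimono)
    fix n assume "n \<in> {..<N}"
    then have "real (Suc n) * (real p * x) \<le> real N * (real p * x)"
      using assms by (intro mult_right_mono) auto
    then show "real (Suc n) * (real p * x) \<le> real (N * p) * x" by (simp add: mult_ac)
  qed (use assms in auto)
  also have "\<dots> \<le> euler_log (real p * x)"
    unfolding euler_log_def using assms
    by (intro sum_le_suminf summable_neg_log1m_exp) (auto intro!: less_imp_le neg_log1m_exp_pos)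
  finally show ?thesis .
qed

text \<open>The hypothesis is lexicographic positivity of (ap + b, a), the coefficients of L(px) and
  D(x). If the first is positive, L(px) outgrows a D(x); if it is 0, only a D(x) remains.\<close>

lemma euler_log_combination_at_top:
  fixes a b :: int
  assumes "p > 1" and ab: "a * int p + b > 0 \<or> a * int p + b = 0 \<and> a > 0"
  shows "filterlim (\<lambda>x. of_int a * euler_log x + of_int b * euler_log (real p * x))
           at_top (at_right 0)"
proof -
  let ?D = "\<lambda>x. euler_log x - real p * euler_log (real p * x)"
  have eq: "of_int a * euler_log x + of_int b * euler_log (real p * x) =
              of_int a * ?D x + of_int (a * int p + b) * euler_log (real p * x)" for x
    by (simp add: algebra_simps)
  from ab show ?thesis
  proof
    assume "a * int p + b = 0 \<and> a > 0"
    then show ?thesis unfolding eq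
      using filterlim_tendsto_pos_mult_at_top[OF tendsto_const _ euler_log_defect_at_top[OF \<open>p > 1\<close>],
              of "of_int a"]
      by simp
  next
    assume pos: "a * int p + b > 0"
    \<comment> \<open>Of the N copies of h(x) below L(px), |a|p absorb a D(x) and one is left to
      tend to infinity. \<open>C\<close> collects the constants from
      \<open>euler_log_ge\<close>.\<close>
    define N where "N = nat \<bar>a\<bar> * p + 1"
    define C where "C = real N * ln (real (N * p))"
    have h: "filterlim neg_log1m_exp at_top (at_right 0)"
      unfolding neg_log1m_exp_def by real_asymp
    have "filterlim (\<lambda>x. - C + neg_log1m_exp x) at_top (at_right 0)"
      by (intro filterlim_tendsto_add_at_top[OF tendsto_const h])
    moreover have "eventually (\<lambda>x. 0 \<le> ?D x) (at_right 0)"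
      using euler_log_defect_at_top[OF \<open>p > 1\<close>] unfolding filterlim_at_top by blast
    then have "eventually (\<lambda>x. - C + neg_log1m_exp x \<le>
         of_int a * euler_log x + of_int b * euler_log (real p * x)) (at_right 0)"
      using eventually_at_right_less
    proof eventually_elim
      case (elim x)
      have "- of_int a * ?D x \<le> \<bar>of_int a\<bar> * ?D x"
        using elim by (intro mult_right_mono) auto
      also have "\<dots> \<le> \<bar>of_int a\<bar> * (real p * neg_log1m_exp x)"
        using elim \<open>p > 1\<close> by (intro mult_left_mono euler_log_defect_le) auto
      finally have 1: "of_int a * ?D x \<ge> - (\<bar>of_int a\<bar> * real p * neg_log1m_exp x)"
        by simp
      have "real N * (neg_log1m_exp x - ln (real (N * p))) \<le> euler_log (real p * x)"
        using elim \<open>p > 1\<close> by (intro euler_log_ge) (auto simp: N_def)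
      then have 2: "(\<bar>of_int a\<bar> * real p + 1) * neg_log1m_exp x - C \<le> euler_log (real p * x)"
        by (simp add: C_def N_def algebra_simps)
      have "0 \<le> euler_log (real p * x)"
        unfolding euler_log_def using elim \<open>p > 1\<close>
        by (intro suminf_nonneg summable_neg_log1m_exp) (auto intro!: less_imp_le neg_log1m_exp_pos)
      \<comment> \<open>A positive integer is at least 1, so one copy of L(px) suffices.\<close>
      then have "1 * euler_log (real p * x) \<le> of_int (a * int p + b) * euler_log (real p * x)"
        using pos by (intro mult_right_mono) linarith+
      with 1 2 show ?case unfolding eq by (simp add: algebra_simps)
    qed
    ultimately show ?thesis
      by (rule filterlim_at_top_mono)
  qed
qed

section \<open>Eta quotients on the imaginary axis\<close>

lemma eta_quotient_imaginary_axis: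
  assumes "t > 0" "p > 0"
  shows "eta_quotient p a b (\<i> * of_real t) =
           of_real (exp (- (2 * pi * t / 24 * (of_int a + of_int b * real p)) -
             (of_int a * euler_log (2 * pi * t) + of_int b * euler_log (real p * (2 * pi * t)))))"
proof -
  have p: "of_nat p * (\<i> * complex_of_real t) = \<i> * of_real (real p * t)"
    by simp
  have powi: "complex_of_real (exp y) powi n = of_real (exp (of_int n * y))" for y n
    by (simp add: exp_power_int mult.commute flip: of_real_power_int)
  have "eta_quotient p a b (\<i> * of_real t) =
          of_real (exp (of_int a * (- (2 * pi * t / 24) - euler_log (2 * pi * t)))) *
          of_real (exp (of_int b * (- (2 * pi * (real p * t) / 24) - euler_log (2 * pi * (real p * t)))))"
    using assms unfolding eta_quotient_def p
    by (simp add: upper_half_plane_def dedekind_eta_imaginary_axis powi del: of_real_exp of_real_mult)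
  then show ?thesis
    by (simp add: algebra_simps flip: exp_add of_real_mult)
qed

text \<open>The fractional power of q tends to 1 as t tends to 0, so the decay comes from the
  combination of L(x) and L(px) at x = 2 pi t.\<close>

lemma eta_quotient_tendsto_0:
  fixes a b :: int
  assumes "p > 1" and ab: "a * int p + b > 0 \<or> a * int p + b = 0 \<and> a > 0"
  shows "((\<lambda>t. eta_quotient p a b (\<i> * of_real t)) \<longlongrightarrow> 0) (at_right 0)"
proof -
  let ?g = "\<lambda>x. of_int a * euler_log x + of_int b * euler_log (real p * x)"
  have "filterlim (\<lambda>t. 2 * pi * t) (at_right 0) (at_right 0)"
    by real_asymp
  with euler_log_combination_at_top[OF assms]
  have g: "filterlim (\<lambda>t. ?g (2 * pi * t)) at_top (at_right 0)"
    by (rule filterlim_compose)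
  have "((\<lambda>t. 2 * pi * t / 24 * (of_int a + of_int b * real p)) \<longlongrightarrow>
          2 * pi * 0 / 24 * (of_int a + of_int b * real p)) (at_right 0)"
    by (intro tendsto_intros) auto
  from filterlim_tendsto_add_at_top[OF this g]
  have "filterlim (\<lambda>t. - (2 * pi * t / 24 * (of_int a + of_int b * real p) + ?g (2 * pi * t)))
          at_bot (at_right 0)"
    by (simp only: filterlim_uminus_at_top)
  then have "((\<lambda>t. exp (- (2 * pi * t / 24 * (of_int a + of_int b * real p) + ?g (2 * pi * t))))
          \<longlongrightarrow> 0) (at_right 0)"
    by (rule filterlim_compose[OF exp_at_bot])
  then have "((\<lambda>t. complex_of_real (exp (- (2 * pi * t / 24 * (of_int a + of_int b * real p)
                      + ?g (2 * pi * t))))) \<longlongrightarrow> of_real 0) (at_right 0)"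
    by (rule tendsto_of_real)
  moreover have "eventually (\<lambda>t. complex_of_real (exp (- (2 * pi * t / 24 *
        (of_int a + of_int b * real p) + ?g (2 * pi * t)))) =
        eta_quotient p a b (\<i> * of_real t)) (at_right 0)"
    using eventually_at_right_less
  proof eventually_elim
    case (elim t)
    show ?case
      using eta_quotient_imaginary_axis[OF elim, of p a b] \<open>p > 1\<close>
      by (simp only: minus_add_distrib diff_conv_add_uminus)
  qed
  ultimately show ?thesis
    by (simp add: tendsto_cong)
qed

lemma eta_quotient_imaginary_axis_nonzero:
  assumes "t > 0" "p > 0"
  shows "eta_quotient p a b (\<i> * of_real t) \<noteq> 0"
  using eta_quotient_imaginary_axis[OF assms] by simp

lemma eta_quotient_imaginary_axis_divide:
  assumes "t > 0" "p > 0"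
  shows "eta_quotient p a b (\<i> * of_real t) / eta_quotient p c d (\<i> * of_real t) =
           eta_quotient p (a - c) (b - d) (\<i> * of_real t)"
  using assms
  by (simp add: eta_quotient_imaginary_axis algebra_simps flip: of_real_divide exp_diff del: of_real_exp)

text \<open>A ratio of eta quotients is again one, with the exponents subtracted. The difference of
  two distinct exponent pairs or its negative is lexicographically positive.\<close>

lemma eta_quotient_ratio_tendsto_0:
  assumes "p > 1" and "(a, b) \<noteq> (c, d)"
  shows "((\<lambda>t. eta_quotient p a b (\<i> * of_real t) / eta_quotient p c d (\<i> * of_real t)) \<longlongrightarrow> 0) (at_right 0) \<or>
         ((\<lambda>t. eta_quotient p c d (\<i> * of_real t) / eta_quotient p a b (\<i> * of_real t)) \<longlongrightarrow> 0) (at_right 0)"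
proof -
  have cong: "((\<lambda>t. eta_quotient p a b (\<i> * of_real t) / eta_quotient p c d (\<i> * of_real t)) \<longlongrightarrow> 0) (at_right 0)"
    if "((\<lambda>t. eta_quotient p (a - c) (b - d) (\<i> * of_real t)) \<longlongrightarrow> 0) (at_right 0)" for a b c d
  proof (rule Lim_transform_eventually[OF that])
    show "eventually (\<lambda>t. eta_quotient p (a - c) (b - d) (\<i> * of_real t) =
            eta_quotient p a b (\<i> * of_real t) / eta_quotient p c d (\<i> * of_real t)) (at_right 0)"
      using eventually_at_right_less
      by eventually_elim (use \<open>p > 1\<close> in \<open>simp add: eta_quotient_imaginary_axis_divide\<close>)
  qed
  have *: "(a - c) * int p + (b - d) = - ((c - a) * int p + (d - b))"
    by (simp add: algebra_simps)
  have "a = c \<Longrightarrow> b \<noteq> d"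
    using assms by simp
  then consider "(a - c) * int p + (b - d) > 0 \<or> (a - c) * int p + (b - d) = 0 \<and> a - c > 0"
    | "(c - a) * int p + (d - b) > 0 \<or> (c - a) * int p + (d - b) = 0 \<and> c - a > 0"
    unfolding * by (cases "a = c"; cases "a < c") fastforce+
  then show ?thesis
    using cong eta_quotient_tendsto_0[OF \<open>p > 1\<close>] by cases blast+
qed

section \<open>Linear independence of all eta quotients\<close>

lemma eta_quotients_coeffs_eq_0:
  assumes "p > 1"
    and S: "S \<subseteq> {f. \<exists>a b. f = eta_quotient p a b}" "finite S"
    and sum0: "\<And>z. (\<Sum>v\<in>S. u v * v z) = 0"
    and "f \<in> S"
  shows "u f = 0"
proof -
  \<comment> \<open>The functions themselves serve as indices, restricted to the imaginary axis;
    distinct functions automatically have distinct exponent pairs.\<close>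
  define e where "e v t = v (\<i> * complex_of_real t)" for v :: "complex \<Rightarrow> complex" and t
  have nz: "eventually (\<lambda>t. e g t \<noteq> 0) (at_right 0)" if "g \<in> S" for g
  proof -
    from that S obtain a b where g: "g = eta_quotient p a b" by blast
    show ?thesis
      unfolding g e_def using eventually_at_right_less
      by eventually_elim (use assms eta_quotient_imaginary_axis_nonzero in simp)
  qed
  have ratio: "((\<lambda>t. e g t / e h t) \<longlongrightarrow> 0) (at_right 0) \<or> ((\<lambda>t. e h t / e g t) \<longlongrightarrow> 0) (at_right 0)"
    if gh: "g \<in> S" "h \<in> S" "g \<noteq> h" for g h
  proof -
    from gh S obtain a b c d where eq: "g = eta_quotient p a b" "h = eta_quotient p c d" by blast
    with gh have "(a, b) \<noteq> (c, d)" by auto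
    from eta_quotient_ratio_tendsto_0[OF \<open>p > 1\<close> this] show ?thesis unfolding eq e_def .
  qed
  have ev: "eventually (\<lambda>t. (\<Sum>v\<in>S. u v * e v t) = 0) (at_right 0)"
    unfolding e_def by (intro always_eventually allI sum0)
  show "u f = 0"
    by (rule asymptotic_scale_linear_independent[of S "at_right 0" e u f])
       (fact \<open>finite S\<close> trivial_limit_at_right_real nz ratio ev \<open>f \<in> S\<close>)+
qed

lemma eta_quotients_independent:
  assumes "p > 1"
  shows "cfun.independent {f. \<exists>a b. f = eta_quotient p a b}"
proof
  assume "cfun.dependent {f. \<exists>a b. f = eta_quotient p a b}"
  then obtain S u where S: "finite S" "S \<subseteq> {f. \<exists>a b. f = eta_quotient p a b}"
    and zero: "(\<Sum>v\<in>S. (\<lambda>z. u v * v z)) = 0" and u: "\<exists>v\<in>S. u v \<noteq> 0"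
    unfolding cfun.dependent_explicit by blast
  have "(\<Sum>v\<in>S. u v * v z) = 0" for z
  proof -
    have "(\<Sum>v\<in>S. (\<lambda>z. u v * v z)) z = (\<Sum>v\<in>S. u v * v z)"
      by (induction S rule: infinite_finite_induct) auto
    then show ?thesis using zero by simp
  qed
  with u show False
    using eta_quotients_coeffs_eq_0[OF assms S(2) S(1), of u] by blast
qed

theorem theorem1p5:
  fixes p :: nat and k :: int
  assumes "prime p" and "p > 3"
  shows "cfun.independent
           {f \<in> modular_forms k (Gamma1 p). \<exists>r\<^sub>1 r\<^sub>p :: int. f = eta_quotient p r\<^sub>1 r\<^sub>p}"
proof -
  \<comment> \<open>Independence passes to subsets, so modularity serves only to select a
    subset.\<close>
  have "cfun.independent {f. \<exists>a b. f = eta_quotient p a b}"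
    using assms by (intro eta_quotients_independent) simp
  then show ?thesis
    by (rule cfun.independent_mono) blast
qed

end
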